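(* If $\varepsilon_n=n^{-\beta}$ with $\beta>\tfrac12$, and $0<\mu_n\le\sqrt{2\log(n)}$, then asymptotically (as $n\to\infty$) Fisher's statistic $F_n=-2\sum_{1\le i\le n}\log(p_i)$ is unable to separate $H_1^{(n)}$ and $H_0$.
   Context: Hypotheses: under $H_0$, $X_1,\dots,X_n$ are i.i.d. $N(0,1)$; under $H_1^{(n)}$, $X_1,\dots,X_n$ are i.i.d. from the mixture $(1-\varepsilon_n)N(0,1)+\varepsilon_nN(\mu_n,1)$. The $p$-values are $p_i=P\{N(0,1)>X_i\}$, $1\le i\le n$. Two hypotheses are said to be separated asymptotically by a procedure if the sum of its Type I and Type II errors tends to $0$ as $n\to\infty$; "$F_n$ is unable to separate" means that no sequence of tests based on $F_n$ achieves this. *)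

theory Defs
  imports "HOL-Probability.Probability"
begin

definition normal_law :: "real \<Rightarrow> real measure" where
  "normal_law \<mu> = density lborel (\<lambda>x. ennreal (normal_density \<mu> 1 x))"

definition mixture_law :: "real \<Rightarrow> real \<Rightarrow> real measure" where
  "mixture_law \<epsilon> \<mu> =
     density lborel (\<lambda>x. ennreal ((1 - \<epsilon>) * normal_density 0 1 x + \<epsilon> * normal_density \<mu> 1 x))"

text \<open>Joint law of an i.i.d. sample \<open>X\<^sub>1, \<dots>, X\<^sub>n\<close> with common law \<open>M\<close>.\<close>

definition iid_sample :: "nat \<Rightarrow> real measure \<Rightarrow> (nat \<Rightarrow> real) measure" where
  "iid_sample n M = (\<Pi>\<^sub>M i\<in>{1..n}. M)"

definition p_value :: "real \<Rightarrow> real" where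
  "p_value x = measure (normal_law 0) {x<..}"

definition fisher_stat :: "nat \<Rightarrow> (nat \<Rightarrow> real) \<Rightarrow> real" where
  "fisher_stat n x = - 2 * (\<Sum>i=1..n. ln (p_value (x i)))"

text \<open>
  A possibly randomized test on an observation space \<open>M\<close> is a measurable function into
  \<open>[0,1]\<close>, its value being the probability of rejecting the null hypothesis. The
  non-randomized tests are the indicator functions of measurable rejection regions.
\<close>

definition critical_function :: "'a measure \<Rightarrow> ('a \<Rightarrow> real) \<Rightarrow> bool" where
  "critical_function M \<phi> \<longleftrightarrow>
     \<phi> \<in> borel_measurable M \<and> (\<forall>x\<in>space M. 0 \<le> \<phi> x \<and> \<phi> x \<le> 1)"

definition type_I_error :: "'a measure \<Rightarrow> ('a \<Rightarrow> real) \<Rightarrow> real" where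
  "type_I_error H0 \<phi> = (\<integral>x. \<phi> x \<partial>H0)"

definition type_II_error :: "'a measure \<Rightarrow> ('a \<Rightarrow> real) \<Rightarrow> real" where
  "type_II_error H1 \<phi> = (\<integral>x. 1 - \<phi> x \<partial>H1)"

definition separates_asymptotically ::
  "(nat \<Rightarrow> 'a measure) \<Rightarrow> (nat \<Rightarrow> 'a measure) \<Rightarrow> (nat \<Rightarrow> 'a \<Rightarrow> real) \<Rightarrow> bool" where
  "separates_asymptotically H0 H1 \<phi> \<longleftrightarrow>
     (\<lambda>n. type_I_error (H0 n) (\<phi> n) + type_II_error (H1 n) (\<phi> n)) \<longlonglongrightarrow> 0"

text \<open>
  A test based on the statistic \<open>T n\<close> sees the data only through the value of \<open>T n\<close>. The
  sequence of tests is otherwise arbitrary; in particular it may depend on \<open>H0\<close> and \<open>H1\<close>.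
\<close>

definition unable_to_separate ::
  "(nat \<Rightarrow> 'a measure) \<Rightarrow> (nat \<Rightarrow> 'a measure) \<Rightarrow> (nat \<Rightarrow> 'a \<Rightarrow> real) \<Rightarrow> bool" where
  "unable_to_separate H0 H1 T \<longleftrightarrow>
     \<not> (\<exists>\<psi> :: nat \<Rightarrow> real \<Rightarrow> real. (\<forall>n. critical_function borel (\<psi> n)) \<and>
          separates_asymptotically H0 H1 (\<lambda>n x. \<psi> n (T n x)))"

end

theory Submission
  imports Defs "HOL-Real_Asymp.Real_Asymp"
begin

text \<open>
  Under \<open>H\<^sub>0\<close> the variables \<open>Y\<^sub>i = - ln p\<^sub>i\<close> are i.i.d. exponential; under \<open>H\<^sub>1\<close> their law is a
  mixture that puts weight \<open>\<epsilon>\<close> on a law with mean \<open>O(1 + \<mu>\<^sup>2)\<close>, because \<open>p(x)\<close> is at least the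
  normal density at \<open>\<bar>x\<bar> + 1\<close>. Turn the exponential summands into mixture summands one at a time.
  The sum of \<open>m\<close> exponential variables has an Erlang law, and translating it by \<open>s\<close> changes it in
  total variation by \<open>O(s / sqrt m)\<close>, so each replacement costs \<open>O(\<epsilon> (1 + \<mu>\<^sup>2) / sqrt m)\<close>.
  Altogether the laws of \<open>F\<^sub>n\<close> under both hypotheses differ in total variation by
  \<open>O(\<epsilon> (1 + \<mu>\<^sup>2) sqrt n) = O(n powr (1 / 2 - \<beta>) * ln n)\<close>, which tends to \<open>0\<close>.
\<close>

section \<open>Laws as averaging operators on test functions\<close>

text \<open>The Markov operator of adding an independent summand of law \<open>N\<close>. With laws
  acting on test functions, a sum of independent variables becomes a composition of operators, and
  total variation is tested by critical functions of the sum.\<close>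

definition avg :: "real measure \<Rightarrow> (real \<Rightarrow> real) \<Rightarrow> real \<Rightarrow> real" where
  "avg N f t = (\<integral>y. f (t + y) \<partial>N)"

lemma critical_functionD:
  assumes "critical_function borel f"
  shows "f \<in> borel_measurable borel" "0 \<le> f x" "f x \<le> 1" "\<bar>f x\<bar> \<le> 1"
  using assms by (auto simp: critical_function_def abs_le_iff intro: order_trans[of _ 0])

lemma real_distribution_integrable_critical:
  assumes "real_distribution N" "critical_function borel f"
  shows "integrable N (\<lambda>y. f (t + y))"
proof -
  interpret real_distribution N by fact
  note [measurable] = critical_functionD(1)[OF assms(2)]
  show ?thesis
    by (rule integrable_const_bound[where B = 1]) (use critical_functionD[OF assms(2)] in auto)
qed

lemma avg_critical:
  assumes N: "real_distribution N" and f: "critical_function borel f"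
  shows "critical_function borel (avg N f)"
proof -
  interpret real_distribution N by fact
  note [measurable] = critical_functionD(1)[OF f]
  have "avg N f \<in> borel_measurable borel"
    unfolding avg_def by measurable
  moreover have "0 \<le> avg N f t" for t
    unfolding avg_def by (intro Bochner_Integration.integral_nonneg) (use critical_functionD[OF f] in auto)
  moreover have "avg N f t \<le> 1" for t
    unfolding avg_def
    by (intro integral_le_const) (use critical_functionD[OF f] real_distribution_integrable_critical[OF N f] in auto)
  ultimately show ?thesis by (auto simp: critical_function_def)
qed

lemma funpow_avg_critical:
  assumes "real_distribution N" "critical_function borel f"
  shows "critical_function borel ((avg N ^^ n) f)"
  by (induction n) (use assms avg_critical in auto)

text \<open>Carries the error of earlier replacements through one more averaging without enlarging
  it.\<close>

lemma abs_avg_diff_le: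
  assumes N: "real_distribution N"
    and f: "critical_function borel f" and g: "critical_function borel g"
    and B: "\<And>x. \<bar>f x - g x\<bar> \<le> B"
  shows "\<bar>avg N f t - avg N g t\<bar> \<le> B"
proof -
  interpret real_distribution N by fact
  note int = real_distribution_integrable_critical[OF N]
  have "avg N f t - avg N g t = (\<integral>y. f (t + y) - g (t + y) \<partial>N)"
    unfolding avg_def using int[OF f] int[OF g] by simp
  also have "\<bar>\<dots>\<bar> \<le> (\<integral>y. \<bar>f (t + y) - g (t + y)\<bar> \<partial>N)"
    by (rule integral_abs_bound)
  also have "\<dots> \<le> B"
    by (intro integral_le_const integrable_abs Bochner_Integration.integrable_diff int f g) (use B in auto)
  finally show ?thesis .
qed

text \<open>A Lipschitz test function feels a new summand only through its first absolute moment;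
  the final bound therefore depends on \<open>N\<close> through that moment alone.\<close>

lemma abs_avg_minus_le_lipschitz:
  assumes N: "real_distribution N" "integrable N (\<lambda>y. y)" and f: "critical_function borel f"
    and L: "\<And>x y. \<bar>f x - f y\<bar> \<le> C * \<bar>x - y\<bar>"
  shows "\<bar>avg N f t - f t\<bar> \<le> C * (\<integral>y. \<bar>y\<bar> \<partial>N)"
proof -
  interpret real_distribution N by fact
  note int = real_distribution_integrable_critical[OF N(1) f]
  have "avg N f t - f t = (\<integral>y. f (t + y) - f t \<partial>N)"
    unfolding avg_def using int prob_space by simp
  also have "\<bar>\<dots>\<bar> \<le> (\<integral>y. \<bar>f (t + y) - f t\<bar> \<partial>N)"
    by (rule integral_abs_bound)
  also have "\<dots> \<le> (\<integral>y. C * \<bar>y\<bar> \<partial>N)"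
    by (intro integral_mono integrable_abs Bochner_Integration.integrable_diff int integrable_const
      integrable_mult_right N) (use L[of "t + _" t] in auto)
  finally show ?thesis by simp
qed

text \<open>Peeling off the last coordinate leaves a sum of \<open>n\<close> terms with starting
  point \<open>t + L y\<close>, hence the induction over arbitrary \<open>t\<close>.\<close>

lemma integral_iid_sum:
  assumes M: "prob_space M" and L [measurable]: "L \<in> borel_measurable M"
    and h: "critical_function borel h"
  shows "(\<integral>x. h (t + (\<Sum>i=1..n. L (x i))) \<partial>(\<Pi>\<^sub>M i\<in>{1..n}. M)) = (avg (distr M borel L) ^^ n) h t"
proof (induction n arbitrary: t)
  case 0
  interpret M: prob_space M by fact
  interpret product_sigma_finite "\<lambda>i::nat. M" ..
  show ?case by (simp add: PiM_empty lebesgue_integral_count_space_finite)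
next
  case (Suc n)
  interpret M: prob_space M by fact
  interpret product_sigma_finite "\<lambda>i::nat. M" ..
  interpret P: prob_space "\<Pi>\<^sub>M i\<in>{1..n}. M" by (intro prob_space_PiM M)
  interpret P': prob_space "\<Pi>\<^sub>M i\<in>{1..Suc n}. M" by (intro prob_space_PiM M)
  interpret pair_sigma_finite "\<Pi>\<^sub>M i\<in>{1..n}. M" M ..
  interpret PM: prob_space "(\<Pi>\<^sub>M i\<in>{1..n}. M) \<Otimes>\<^sub>M M"
    by (intro prob_space_pair P.prob_space_axioms M)
  note hm [measurable] = critical_functionD(1)[OF h]
  have ins: "{1..Suc n} = insert (Suc n) {1..n}" by auto
  have "integrable (\<Pi>\<^sub>M i\<in>insert (Suc n) {1..n}. M) (\<lambda>x. h (t + (\<Sum>i=1..Suc n. L (x i))))"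
    unfolding ins[symmetric]
    by (rule P'.integrable_const_bound[where B = 1]) (auto simp: critical_functionD[OF h])
  then have "(\<integral>x. h (t + (\<Sum>i=1..Suc n. L (x i))) \<partial>(\<Pi>\<^sub>M i\<in>{1..Suc n}. M)) =
      (\<integral>x. (\<integral>y. h (t + (\<Sum>i=1..Suc n. L ((x(Suc n := y)) i))) \<partial>M) \<partial>(\<Pi>\<^sub>M i\<in>{1..n}. M))"
    unfolding ins by (intro product_integral_insert) auto
  also have "\<dots> = (\<integral>x. (\<integral>y. h (t + L y + (\<Sum>i=1..n. L (x i))) \<partial>M) \<partial>(\<Pi>\<^sub>M i\<in>{1..n}. M))"
  proof -
    have "(\<Sum>i=1..n. L (if i = Suc n then y else x i)) = (\<Sum>i=1..n. L (x i))" for x y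
      by (rule sum.cong) auto
    then show ?thesis by (simp add: algebra_simps)
  qed
  \<comment> \<open>Fubini puts the new coordinate outside, matching the outermost
    \<open>avg\<close> of the iterate of order \<open>Suc n\<close>.\<close>
  also have "\<dots> = (\<integral>y. (\<integral>x. h (t + L y + (\<Sum>i=1..n. L (x i))) \<partial>(\<Pi>\<^sub>M i\<in>{1..n}. M)) \<partial>M)"
  proof (rule Fubini_integral[symmetric])
    show "integrable ((\<Pi>\<^sub>M i\<in>{1..n}. M) \<Otimes>\<^sub>M M) (\<lambda>(x, y). h (t + L y + (\<Sum>i=1..n. L (x i))))"
      by (rule PM.integrable_const_bound[where B = 1]) (auto simp: critical_functionD[OF h])
  qed
  also have "\<dots> = (\<integral>y. (avg (distr M borel L) ^^ n) h (t + L y) \<partial>M)"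
    by (simp only: Suc.IH)
  also have "\<dots> = (avg (distr M borel L) ^^ Suc n) h t"
    using funpow_avg_critical[OF _ h, THEN critical_functionD(1), of "distr M borel L"]
      M.real_distribution_distr[OF L]
    by (simp add: avg_def integral_distr)
  finally show ?case .
qed

section \<open>Erlang laws\<close>

text \<open>The law of a sum of \<open>k + 1\<close> independent exponential variables of rate 1; in
  particular \<open>erlang_law 0\<close> is the exponential law.\<close>

abbreviation erlang_law :: "nat \<Rightarrow> real measure" where
  "erlang_law k \<equiv> density lborel (\<lambda>x. ennreal (erlang_density k 1 x))"

lemma real_distribution_erlang: "real_distribution (erlang_law k)"
  by (intro real_distribution.intro real_distribution_axioms.intro prob_space_erlang_density) auto

text \<open>Exhibits the identity as an Erlang random variable, the form in which moments and
  variance are known.\<close>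

lemma distributed_erlang_law: "distributed (erlang_law k) lborel (\<lambda>y. y) (erlang_density k 1)"
  by (auto simp: distributed_def cong: distr_cong)
     (metis distr_id2 sets_density sets_lborel)

lemma avg_convolution:
  assumes M: "real_distribution M" and N: "real_distribution N" and f: "critical_function borel f"
  shows "avg M (avg N f) = avg (M \<star> N) f"
proof
  fix t
  interpret M: real_distribution M by fact
  interpret N: real_distribution N by fact
  interpret pair_sigma_finite M N ..
  interpret MN: prob_space "M \<Otimes>\<^sub>M N"
    by (intro prob_space_pair M.prob_space_axioms N.prob_space_axioms)
  note [measurable] = critical_functionD(1)[OF f]
  have "avg (M \<star> N) f t = (\<integral>p. f (t + (fst p + snd p)) \<partial>(M \<Otimes>\<^sub>M N))"
    unfolding avg_def convolution_def by (subst integral_distr) (auto simp: split_beta')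
  also have "\<dots> = (\<integral>x. (\<integral>y. f (t + (x + y)) \<partial>N) \<partial>M)"
    by (subst integral_fst'[symmetric])
       (auto intro!: MN.integrable_const_bound[where B = 1] simp: critical_functionD[OF f])
  finally show "avg M (avg N f) t = avg (M \<star> N) f t"
    by (simp add: avg_def add.assoc)
qed

text \<open>Convolving the exponential law with \<open>erlang_law k\<close> gives
  \<open>erlang_law (Suc k)\<close>. The index is one less than the number of summands.\<close>

lemma funpow_avg_exponential:
  assumes f: "critical_function borel f"
  shows "(avg (erlang_law 0) ^^ Suc k) f = avg (erlang_law k) f"
proof (induction k)
  case (Suc k)
  have fin: "finite_measure (erlang_law k)" for k
    using prob_space_erlang_density[of 1 k] by (simp add: prob_space_def)
  have "(avg (erlang_law 0) ^^ Suc (Suc k)) f = avg (erlang_law 0) (avg (erlang_law k) f)"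
    using Suc.IH by simp
  also have "\<dots> = avg (erlang_law 0 \<star> erlang_law k) f"
    by (intro avg_convolution real_distribution_erlang f)
  also have "erlang_law 0 \<star> erlang_law k = erlang_law (Suc k)"
    by (subst convolution_density) (auto simp: fin convolution_erlang_density[of 1 0 k])
  finally show ?case .
qed simp

text \<open>Relative to \<^term>\<open>erlang_law k\<close>, the density of \<^term>\<open>erlang_law (Suc k)\<close> is
  \<open>y / (k + 1)\<close>, so the two differ in total variation by at most the
  standard deviation of \<open>y / (k + 1)\<close>.\<close>

lemma abs_avg_erlang_Suc_diff_le:
  assumes f: "critical_function borel f"
  shows "\<bar>avg (erlang_law (Suc k)) f t - avg (erlang_law k) f t\<bar> \<le> 1 / sqrt (real (Suc k))"
proof -
  interpret real_distribution "erlang_law k" by (rule real_distribution_erlang)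
  note [measurable] = critical_functionD(1)[OF f]
  define n where "n = real (Suc k)"
  have n: "n > 0" by (simp add: n_def)
  note D = distributed_erlang_law[of k]
  have int [simp]: "integrable (erlang_law k) (\<lambda>y. y ^ i)" for i
    using erlang_ith_moment_integrable[OF _ D] by simp
  have int1: "integrable (erlang_law k) (\<lambda>y. y)"
    using int[of 1] by simp
  have E1: "expectation (\<lambda>y. y) = n"
    using erlang_ith_moment[OF _ D, of 1] by (simp add: n_def)
  have V: "expectation (\<lambda>y. (y - n)\<^sup>2) = n"
    using erlang_distributed_variance[OF _ D] by (simp add: E1 n_def add.commute)
  have int2: "integrable (erlang_law k) (\<lambda>y. (y - n)\<^sup>2)"
    by (simp add: power2_diff int1)
  have ratio: "erlang_density (Suc k) 1 y = erlang_density k 1 y * (y / n)" for y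
    by (simp add: erlang_density_def n_def mult_ac del: of_nat_Suc)
  have "avg (erlang_law (Suc k)) f t = (\<integral>y. erlang_density (Suc k) 1 y * f (t + y) \<partial>lborel)"
    unfolding avg_def by (subst integral_density) auto
  also have "\<dots> = (\<integral>y. erlang_density k 1 y * (y / n * f (t + y)) \<partial>lborel)"
    by (simp add: ratio mult.assoc)
  also have "\<dots> = expectation (\<lambda>y. y / n * f (t + y))"
    by (subst integral_density) auto
  finally have S: "avg (erlang_law (Suc k)) f t = expectation (\<lambda>y. y / n * f (t + y))" .
  have int3: "integrable (erlang_law k) (\<lambda>y. y / n * f (t + y))"
  proof (rule Bochner_Integration.integrable_bound)
    show "integrable (erlang_law k) (\<lambda>y. y / n)"
      using int1 by simp
    have "\<bar>y / n * f (t + y)\<bar> \<le> \<bar>y / n\<bar>" for y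
      unfolding abs_mult by (intro mult_left_le critical_functionD(4)[OF f]) simp
    then show "AE y in erlang_law k. norm (y / n * f (t + y)) \<le> norm (y / n)"
      by simp
  qed simp
  have int4: "integrable (erlang_law k) (\<lambda>y. f (t + y))"
    by (rule real_distribution_integrable_critical[OF real_distribution_erlang f])
  have "avg (erlang_law (Suc k)) f t - avg (erlang_law k) f t
      = expectation (\<lambda>y. y / n * f (t + y) - f (t + y))"
    unfolding S using int3 int4 by (simp add: avg_def)
  also have "\<dots> = expectation (\<lambda>y. (y - n) / n * f (t + y))"
    using n by (intro Bochner_Integration.integral_cong) (auto simp: field_simps)
  also have "\<bar>\<dots>\<bar> \<le> expectation (\<lambda>y. \<bar>(y - n) / n * f (t + y)\<bar>)"
    by (rule integral_abs_bound)
  also have "\<dots> \<le> expectation (\<lambda>y. \<bar>y - n\<bar> / n)"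
  proof (rule integral_mono')
    show "integrable (erlang_law k) (\<lambda>y. \<bar>y - n\<bar> / n)"
      using int1 by simp
    show "\<bar>(y - n) / n * f (t + y)\<bar> \<le> \<bar>y - n\<bar> / n" for y
    proof -
      have "\<bar>(y - n) / n * f (t + y)\<bar> \<le> \<bar>(y - n) / n\<bar>"
        unfolding abs_mult by (intro mult_left_le critical_functionD(4)[OF f]) simp
      then show ?thesis using n by simp
    qed
  qed (use n in simp)
  also have "\<dots> = expectation (\<lambda>y. \<bar>y - n\<bar>) / n"
    by simp
  also have "\<dots> \<le> sqrt n / n"
  proof (rule divide_right_mono)
    \<comment> \<open>Nonnegativity of the variance of \<open>\<bar>y - n\<bar>\<close> serves as
      Cauchy-Schwarz.\<close>
    have "(expectation (\<lambda>y. \<bar>y - n\<bar>))\<^sup>2 \<le> expectation (\<lambda>y. \<bar>y - n\<bar>\<^sup>2)"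
      using variance_positive[of "\<lambda>y. \<bar>y - n\<bar>"] int1 int2 by (subst (asm) variance_eq) auto
    then show "expectation (\<lambda>y. \<bar>y - n\<bar>) \<le> sqrt n"
      using V by (intro real_le_rsqrt) simp
  qed (use n in simp)
  also have "\<dots> = 1 / sqrt n"
    using n by (simp add: real_div_sqrt field_simps)
  finally show ?thesis by (simp add: n_def)
qed

section \<open>Smoothing by exponential averaging\<close>

text \<open>Substituting \<open>u = t + y\<close> turns the average into \<open>exp t\<close> times
  the integral of \<open>exp (- u) * f u\<close> over \<open>u \<ge> t\<close>. Writing this tail as
  the tail from a base point \<open>a\<close> minus the integral over \<open>{a..t}\<close> moves
  \<open>t\<close> into an upper limit, where calculus applies.\<close>

lemma avg_exponential_eq_integral:
  assumes f: "critical_function borel f" and "a \<le> t"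
  shows "(\<lambda>u. exp (- u) * f u) integrable_on {a..t}"
    and "avg (erlang_law 0) f t =
      exp t * (exp (- a) * avg (erlang_law 0) f a - integral {a..t} (\<lambda>u. exp (- u) * f u))"
proof -
  note [measurable] = critical_functionD(1)[OF f]
  let ?g = "\<lambda>s u. indicator {s..} u * (exp (- u) * f u)"
  have shift: "?g s (s + y) = exp (- s) * (erlang_density 0 1 y * f (s + y))" for s y
  proof -
    have "exp (- (s + y)) = exp (- s) * exp (- y)"
      by (simp flip: exp_add)
    then show ?thesis
      by (auto simp: erlang_density_def split: split_indicator)
  qed
  have avg_eq: "exp (- s) * avg (erlang_law 0) f s = (\<integral>u. ?g s u \<partial>lborel)" for s
  proof -
    have "(\<integral>u. ?g s u \<partial>lborel) = (\<integral>y. ?g s (s + y) \<partial>lborel)"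
      using lborel_integral_real_affine[of 1 "?g s" s] by simp
    also have "\<dots> = exp (- s) * (\<integral>y. erlang_density 0 1 y * f (s + y) \<partial>lborel)"
      unfolding shift by simp
    also have "(\<integral>y. erlang_density 0 1 y * f (s + y) \<partial>lborel) = avg (erlang_law 0) f s"
      unfolding avg_def by (subst integral_density) auto
    finally show ?thesis by simp
  qed
  have "integrable lborel (\<lambda>y. erlang_density 0 1 y * f (s + y))" for s
    using real_distribution_integrable_critical[OF real_distribution_erlang f, of 0 s]
    by (subst (asm) integrable_density) auto
  then have int: "integrable lborel (?g s)" for s
    unfolding lborel_integrable_real_affine_iff[of 1 "?g s" s, OF one_neq_zero, symmetric] mult_1 shift
    by simp
  have set_int: "set_integrable lborel {a..t} (\<lambda>u. exp (- u) * f u)"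
    unfolding set_integrable_def
    by (rule Bochner_Integration.integrable_bound[OF int[of a]]) (auto split: split_indicator)
  then show "(\<lambda>u. exp (- u) * f u) integrable_on {a..t}"
    by (rule set_borel_integral_eq_integral)
  have "integral {a..t} (\<lambda>u. exp (- u) * f u) = (LINT u:{a..t}|lborel. exp (- u) * f u)"
    using set_borel_integral_eq_integral(2)[OF set_int] by simp
  \<comment> \<open>The two tails differ by \<open>{a..<t}\<close>; the missing endpoint
    \<open>t\<close> is a null set.\<close>
  also have "\<dots> = (\<integral>u. ?g a u - ?g t u \<partial>lborel)"
    unfolding set_lebesgue_integral_def
    by (intro integral_cong_AE, measurable, rule AE_mp[OF AE_lborel_singleton[of t]])
       (use \<open>a \<le> t\<close> in \<open>auto split: split_indicator\<close>)
  also have "\<dots> = exp (- a) * avg (erlang_law 0) f a - exp (- t) * avg (erlang_law 0) f t"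
    using int by (simp add: avg_eq)
  finally show "avg (erlang_law 0) f t =
      exp t * (exp (- a) * avg (erlang_law 0) f a - integral {a..t} (\<lambda>u. exp (- u) * f u))"
    by (simp add: exp_minus field_simps)
qed

text \<open>An indefinite integral is continuous even for a merely measurable bounded test function,
  so a single averaging already yields continuity.\<close>

lemma continuous_avg_exponential:
  assumes f: "critical_function borel f"
  shows "continuous_on UNIV (avg (erlang_law 0) f)"
proof -
  have "isCont (avg (erlang_law 0) f) t" for t
  proof -
    \<comment> \<open>The base point \<open>t - 1\<close> keeps \<open>t\<close> in the interior of
      the interval.\<close>
    have "continuous_on {t - 1..t + 1} (\<lambda>x. exp x * (exp (- (t - 1)) * avg (erlang_law 0) f (t - 1)
        - integral {t - 1..x} (\<lambda>u. exp (- u) * f u)))"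
      by (intro continuous_intros indefinite_integral_continuous_1 avg_exponential_eq_integral f) simp
    then have "continuous_on {t - 1..t + 1} (avg (erlang_law 0) f)"
      by (rule continuous_on_eq) (simp only: avg_exponential_eq_integral(2)[OF f, symmetric] atLeastAtMost_iff)
    then show ?thesis
      by (rule continuous_on_interior) simp
  qed
  then show ?thesis
    by (simp add: continuous_at_imp_continuous_on)
qed

text \<open>Product rule and fundamental theorem of calculus applied to the integral formula; the
  latter uses the continuity of \<open>f\<close>. The derivative under translation is thus the
  effect of one further exponential summand, which the comparison of consecutive Erlang laws
  controls.\<close>

lemma DERIV_avg_exponential:
  assumes f: "critical_function borel f" and cont: "continuous_on UNIV f"
  shows "(avg (erlang_law 0) f has_real_derivative avg (erlang_law 0) f t - f t) (at t)"
proof -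
  let ?F = "\<lambda>x. exp x * (exp (- (t - 1)) * avg (erlang_law 0) f (t - 1)
        - integral {t - 1..x} (\<lambda>u. exp (- u) * f u))"
  have eq: "avg (erlang_law 0) f x = ?F x" if "t - 1 \<le> x" for x
    using avg_exponential_eq_integral(2)[OF f that] .
  have "((\<lambda>x. integral {t - 1..x} (\<lambda>u. exp (- u) * f u)) has_real_derivative exp (- t) * f t)
      (at t within {t - 1..t + 1})"
    by (intro integral_has_real_derivative continuous_intros continuous_on_subset[OF cont]) auto
  then have "((\<lambda>x. integral {t - 1..x} (\<lambda>u. exp (- u) * f u)) has_real_derivative exp (- t) * f t) (at t)"
    using at_within_interior[of t "{t - 1..t + 1}"] by simp
  then have "(?F has_real_derivative ?F t - f t) (at t)"
    by (auto intro!: derivative_eq_intros simp: algebra_simps simp flip: exp_add)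
  then have "(?F has_real_derivative avg (erlang_law 0) f t - f t) (at t)"
    using eq[of t] by simp
  then show ?thesis
    by (rule has_field_derivative_transform_within_open[of _ _ _ "{t - 1<..}"])
       (simp_all only: open_greaterThan greaterThan_iff eq[OF less_imp_le] diff_less_eq less_add_one)
qed

text \<open>The derivative is a difference of two consecutive Erlang averages. One averaging makes
  the function continuous and a second makes it differentiable, so the index starts at 2.\<close>

lemma lipschitz_funpow_avg_exponential:
  assumes h: "critical_function borel h"
  defines "g \<equiv> \<lambda>m. (avg (erlang_law 0) ^^ m) h"
  shows "\<bar>g (Suc (Suc k)) x - g (Suc (Suc k)) y\<bar> \<le> 1 / sqrt (real (Suc k)) * \<bar>x - y\<bar>"
proof -
  have "critical_function borel (g m)" for m
    unfolding g_def by (intro funpow_avg_critical real_distribution_erlang h)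
  moreover have g_Suc: "g (Suc m) = avg (erlang_law 0) (g m)" for m
    by (simp add: g_def)
  ultimately have "(g (Suc (Suc k)) has_real_derivative g (Suc (Suc k)) z - g (Suc k) z) (at z)" for z
    using DERIV_avg_exponential continuous_avg_exponential by metis
  moreover have "\<bar>g (Suc (Suc k)) z - g (Suc k) z\<bar> \<le> 1 / sqrt (real (Suc k))" for z
    unfolding g_def funpow_avg_exponential[OF h] by (rule abs_avg_erlang_Suc_diff_le[OF h])
  ultimately show ?thesis
    using field_differentiable_bound[of UNIV "g (Suc (Suc k))"
      "\<lambda>z. g (Suc (Suc k)) z - g (Suc k) z" "1 / sqrt (real (Suc k))" x y]
    by (simp add: real_norm_def)
qed

section \<open>Replacing the summands one at a time\<close>

text \<open>Replacing one exponential summand by a summand with law \<^term>\<open>Q\<close> costs only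
  \<open>O(\<epsilon> / sqrt m)\<close> when the \<open>m\<close> remaining summands are exponential, and averaging over
  \<^term>\<open>Q\<close> is a contraction, so the costs add up.\<close>

lemma funpow_avg_contamination_bound:
  assumes N: "real_distribution N" "integrable N (\<lambda>y. y)" and Q: "real_distribution Q"
    and mix: "\<And>f s. critical_function borel f \<Longrightarrow>
      avg Q f s = (1 - \<epsilon>) * avg (erlang_law 0) f s + \<epsilon> * avg N f s"
    and \<epsilon>: "0 \<le> \<epsilon>" and h: "critical_function borel h"
  shows "\<bar>(avg (erlang_law 0) ^^ Suc (Suc k)) h t - (avg Q ^^ Suc (Suc k)) h t\<bar>
    \<le> \<epsilon> * (2 + 2 * (1 + (\<integral>y. \<bar>y\<bar> \<partial>N)) * sqrt k)"
proof -
  define P where "P = avg (erlang_law 0)"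
  \<comment> \<open>The 1 is the mean of the exponential summand that is removed.\<close>
  define K where "K = 1 + (\<integral>y. \<bar>y\<bar> \<partial>N)"
  have K: "K \<ge> 0"
    unfolding K_def by (intro add_nonneg_nonneg Bochner_Integration.integral_nonneg) auto
  note crit = funpow_avg_critical[OF _ h]
  have critP: "critical_function borel ((P ^^ n) h)" for n
    unfolding P_def by (rule crit[OF real_distribution_erlang])
  \<comment> \<open>Telescoping: on \<open>(P ^^ n) h\<close> the operators \<open>P\<close> and
    \<open>avg Q\<close> differ by \<epsilon> times the difference of \<open>P\<close> and
    \<open>avg N\<close>, and \<open>avg Q\<close> contracts the old error \<open>D\<close>.\<close>
  have step: "\<bar>(P ^^ Suc n) h t - (avg Q ^^ Suc n) h t\<bar> \<le> D + \<epsilon> * b"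
    if D: "\<And>t. \<bar>(P ^^ n) h t - (avg Q ^^ n) h t\<bar> \<le> D"
      and b: "\<bar>P ((P ^^ n) h) t - avg N ((P ^^ n) h) t\<bar> \<le> b" for n t D b
  proof -
    have "P ((P ^^ n) h) t - avg Q ((P ^^ n) h) t = \<epsilon> * (P ((P ^^ n) h) t - avg N ((P ^^ n) h) t)"
      using mix[OF critP] by (simp add: P_def algebra_simps)
    then have "\<bar>P ((P ^^ n) h) t - avg Q ((P ^^ n) h) t\<bar> \<le> \<epsilon> * b"
      using b \<epsilon> by (simp add: abs_mult mult_left_mono)
    moreover have "\<bar>avg Q ((P ^^ n) h) t - avg Q ((avg Q ^^ n) h) t\<bar> \<le> D"
      by (rule abs_avg_diff_le[OF Q critP crit[OF Q] D])
    ultimately show ?thesis by simp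
  qed
  \<comment> \<open>Both values lie in [0,1]. This trivial bound pays for the first two
    replacements, where at most one exponential summand smooths \<open>h\<close>; they give the
    constant 2.\<close>
  have b1: "\<bar>P ((P ^^ n) h) t - avg N ((P ^^ n) h) t\<bar> \<le> 1" for n t
    using critical_functionD(2,3)[OF critP[of "Suc n"], of t]
      critical_functionD(2,3)[OF avg_critical[OF N(1) critP[of n]], of t] by simp
  \<comment> \<open>Both averages are compared with the test function itself: its Lipschitz constant
    gets multiplied by the mean displacements 1 and \<open>K - 1\<close>.\<close>
  have b2: "\<bar>P ((P ^^ Suc (Suc n)) h) t - avg N ((P ^^ Suc (Suc n)) h) t\<bar> \<le> K / sqrt (Suc n)" for n t
  proof -
    interpret E: real_distribution "erlang_law 0" by (rule real_distribution_erlang)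
    note D = distributed_erlang_law[of 0]
    have iE: "integrable (erlang_law 0) (\<lambda>y. y)"
      using E.erlang_ith_moment_integrable[OF _ D, of 1] by simp
    have "(\<integral>y. \<bar>y\<bar> \<partial>erlang_law 0) = (\<integral>y. y \<partial>erlang_law 0)"
      by (rule integral_cong_AE) (auto simp: AE_density erlang_density_def)
    then have E1: "(\<integral>y. \<bar>y\<bar> \<partial>erlang_law 0) = 1"
      using E.erlang_ith_moment[OF _ D, of 1] by simp
    let ?g = "(P ^^ Suc (Suc n)) h"
    have L: "\<bar>?g x - ?g y\<bar> \<le> 1 / sqrt (Suc n) * \<bar>x - y\<bar>" for x y
      unfolding P_def by (rule lipschitz_funpow_avg_exponential[OF h])
    have "\<bar>P ?g t - ?g t\<bar> \<le> 1 / sqrt (Suc n) * 1"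
      using abs_avg_minus_le_lipschitz[OF real_distribution_erlang iE critP L]
      unfolding E1 P_def .
    moreover have "\<bar>avg N ?g t - ?g t\<bar> \<le> 1 / sqrt (Suc n) * (K - 1)"
      using abs_avg_minus_le_lipschitz[OF N critP L] by (simp add: K_def)
    ultimately have "\<bar>P ?g t - avg N ?g t\<bar> \<le> 1 / sqrt (Suc n) * 1 + 1 / sqrt (Suc n) * (K - 1)"
      by linarith
    then show ?thesis by (simp add: algebra_simps add_divide_distrib diff_divide_distrib)
  qed
  have "\<bar>(P ^^ Suc (Suc k)) h t - (avg Q ^^ Suc (Suc k)) h t\<bar> \<le> \<epsilon> * (2 + 2 * K * sqrt k)" for t
  proof (induction k arbitrary: t)
    case 0
    have "\<bar>(P ^^ Suc 0) h t - (avg Q ^^ Suc 0) h t\<bar> \<le> 0 + \<epsilon> * 1" for t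
      by (rule step) (use b1[of 0] in auto)
    then have "\<bar>(P ^^ Suc (Suc 0)) h t - (avg Q ^^ Suc (Suc 0)) h t\<bar> \<le> (0 + \<epsilon> * 1) + \<epsilon> * 1"
      by (rule step) (rule b1)
    then show ?case by simp
  next
    case (Suc k)
    \<comment> \<open>The inequality of arithmetic and geometric means bounds
      \<open>1 / sqrt (Suc k)\<close> by the increment of \<open>2 * sqrt\<close> from
      \<open>k\<close> to \<open>Suc k\<close>, so the costs telescope.\<close>
    have "sqrt k * sqrt (Suc k) \<le> (real k + real (Suc k)) / 2"
      using arith_geo_mean_sqrt[of "real k" "real (Suc k)"] by (simp add: real_sqrt_mult)
    then have "1 / sqrt (Suc k) \<le> 2 * (sqrt (Suc k) - sqrt k)"
      by (simp add: field_simps del: of_nat_Suc) (simp add: algebra_simps)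
    then have "K / sqrt (Suc k) \<le> K * (2 * (sqrt (Suc k) - sqrt k))"
      using mult_left_mono[OF _ K] by fastforce
    then have "\<epsilon> * (K / sqrt (Suc k)) \<le> \<epsilon> * (K * (2 * (sqrt (Suc k) - sqrt k)))"
      using \<epsilon> by (rule mult_left_mono)
    moreover have "\<bar>(P ^^ Suc (Suc (Suc k))) h t - (avg Q ^^ Suc (Suc (Suc k))) h t\<bar>
        \<le> \<epsilon> * (2 + 2 * K * sqrt k) + \<epsilon> * (K / sqrt (Suc k))"
      by (rule step[OF Suc.IH b2])
    ultimately show ?case by (simp add: algebra_simps)
  qed
  then show ?thesis by (simp only: P_def K_def)
qed

section \<open>Normal law: second moment and interval probabilities\<close>

lemma real_distribution_normal_law: "real_distribution (normal_law \<mu>)"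
  unfolding normal_law_def
  by (intro real_distribution.intro real_distribution_axioms.intro prob_space_normal_density) auto

lemma has_bochner_integral_normal_law_iff:
  assumes [measurable]: "f \<in> borel_measurable borel"
  shows "has_bochner_integral (normal_law \<mu>) f x \<longleftrightarrow>
    has_bochner_integral lborel (\<lambda>y. normal_density \<mu> 1 y * f y) (x :: real)"
  unfolding normal_law_def by (simp add: has_bochner_integral_iff integrable_density integral_density)

lemma has_bochner_integral_normal_law_square:
  "has_bochner_integral (normal_law \<mu>) (\<lambda>x. x\<^sup>2) (\<mu>\<^sup>2 + 1)"
proof -
  \<comment> \<open>Expands \<open>x\<^sup>2\<close> as
    \<open>(x - \<mu>)\<^sup>2 + 2 * \<mu> * x - \<mu>\<^sup>2\<close>, whose terms have known
    integrals.\<close>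
  have "has_bochner_integral lborel (\<lambda>x. normal_density \<mu> 1 x * (x - \<mu>)\<^sup>2
      + 2 * \<mu> * (normal_density \<mu> 1 x * x) - \<mu>\<^sup>2 * normal_density \<mu> 1 x) (1 + 2 * \<mu> * \<mu> - \<mu>\<^sup>2 * 1)"
    using normal_moment_even[of 1 \<mu> 1] normal_moment_nz_1[of 1 \<mu>]
    by (intro has_bochner_integral_add has_bochner_integral_diff has_bochner_integral_mult_right)
       (auto simp: has_bochner_integral_iff fact_numeral)
  then show ?thesis
    by (subst has_bochner_integral_normal_law_iff) (auto simp: algebra_simps power2_eq_square)
qed

lemma measure_normal_law:
  assumes [measurable]: "A \<in> sets borel"
  shows "measure (normal_law \<mu>) A = (\<integral>x. normal_density \<mu> 1 x * indicator A x \<partial>lborel)"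
proof -
  interpret real_distribution "normal_law \<mu>" by (rule real_distribution_normal_law)
  have "measure (normal_law \<mu>) A = (\<integral>x. indicator A x \<partial>normal_law \<mu>)"
    by simp
  also have "\<dots> = (\<integral>x. normal_density \<mu> 1 x * indicator A x \<partial>lborel)"
    unfolding normal_law_def by (subst integral_density) auto
  finally show ?thesis .
qed

lemma integrable_normal_density_indicator:
  assumes [measurable]: "A \<in> sets borel"
  shows "integrable lborel (\<lambda>x. normal_density \<mu> 1 x * indicator A x)"
  by (rule Bochner_Integration.integrable_bound[of _ "normal_density \<mu> 1"])
     (auto split: split_indicator)

text \<open>The standard normal density decreases in the absolute value of its argument. Serves both
  the strict monotonicity of \<open>p_value\<close> and its lower bound.\<close>

lemma measure_std_normal_interval_ge:
  assumes "a \<le> b" "\<bar>a\<bar> \<le> c" "\<bar>b\<bar> \<le> c"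
  shows "std_normal_density c * (b - a) \<le> measure (normal_law 0) {a<..b}"
proof -
  have "std_normal_density c * (b - a) = (\<integral>x. std_normal_density c * indicator {a<..b} x \<partial>lborel)"
    using assms(1) by simp
  also have "\<dots> \<le> (\<integral>x. std_normal_density x * indicator {a<..b} x \<partial>lborel)"
  proof (intro integral_mono integrable_normal_density_indicator)
    fix x
    have "std_normal_density c \<le> std_normal_density x" if "x \<in> {a<..b}"
    proof -
      have "\<bar>x\<bar> \<le> \<bar>c\<bar>" using that assms by auto
      then show ?thesis
        unfolding std_normal_density_def abs_le_square_iff by (simp add: divide_right_mono)
    qed
    then show "std_normal_density c * indicator {a<..b} x \<le> std_normal_density x * indicator {a<..b} x"
      by (simp split: split_indicator)
  qed (use assms(1) in auto)
  finally show ?thesis by (simp add: measure_normal_law)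
qed

text \<open>The density is at most \<open>1 / sqrt (2 * pi)\<close>, hence at most 1. This makes
  \<open>p_value\<close> Lipschitz.\<close>

lemma measure_std_normal_interval_le:
  assumes "a \<le> b"
  shows "measure (normal_law 0) {a<..b} \<le> b - a"
proof -
  have "measure (normal_law 0) {a<..b} \<le> (\<integral>x. indicator {a<..b} x \<partial>lborel)"
    proof (subst measure_normal_law, simp, intro integral_mono integrable_normal_density_indicator)
    fix x :: real
    have "1 / sqrt (2 * pi) \<le> 1"
      using pi_gt3 by simp
    then have "1 / sqrt (2 * pi) * exp (- x\<^sup>2 / 2) \<le> 1"
      by (intro mult_le_one) auto
    then have "std_normal_density x \<le> 1" by (simp add: std_normal_density_def)
    then show "std_normal_density x * indicator {a<..b} x \<le> indicator {a<..b} x"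
      by (simp split: split_indicator)
  qed (use assms in auto)
  also have "\<dots> = b - a" using assms by simp
  finally show ?thesis .
qed

section \<open>The p-value and its logarithm\<close>

lemma p_value_diff: "x \<le> y \<Longrightarrow> p_value x - p_value y = measure (normal_law 0) {x<..y}"
proof -
  interpret real_distribution "normal_law 0" by (rule real_distribution_normal_law)
  assume "x \<le> y"
  then have "{x<..} = {x<..y} \<union> {y<..}" by auto
  then have "p_value x = measure (normal_law 0) {x<..y} + p_value y"
    unfolding p_value_def by (simp add: finite_measure_Union disjoint_iff)
  then show ?thesis by simp
qed

lemma p_value_strict_antimono: "x < y \<Longrightarrow> p_value y < p_value x"
proof -
  assume "x < y"
  have "0 < std_normal_density (max \<bar>x\<bar> \<bar>y\<bar>) * (y - x)"
    using \<open>x < y\<close> by (intro mult_pos_pos normal_density_pos) auto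
  also have "\<dots> \<le> measure (normal_law 0) {x<..y}"
    using \<open>x < y\<close> by (intro measure_std_normal_interval_ge) auto
  finally show ?thesis using p_value_diff[of x y] \<open>x < y\<close> by simp
qed

lemma p_value_le_iff: "p_value x \<le> p_value y \<longleftrightarrow> y \<le> x"
  using p_value_strict_antimono by (metis linorder_not_less order.asym order_le_less)

lemma p_value_eq_1_minus_cdf: "p_value x = 1 - cdf (normal_law 0) x"
proof -
  interpret real_distribution "normal_law 0" by (rule real_distribution_normal_law)
  have "{x<..} = UNIV - {..x}" by auto
  then show ?thesis
    using prob_compl[of "{..x}"] by (simp add: p_value_def cdf_def)
qed

lemma p_value_bounds: "0 < p_value x" "p_value x < 1"
proof -
  interpret real_distribution "normal_law 0" by (rule real_distribution_normal_law)
  have "0 \<le> p_value (x + 1)" "p_value (x - 1) \<le> 1"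
    by (simp_all add: p_value_def)
  then show "0 < p_value x" "p_value x < 1"
    using p_value_strict_antimono[of x "x + 1"] p_value_strict_antimono[of "x - 1" x] by auto
qed

lemma continuous_p_value: "continuous_on UNIV p_value"
proof (rule lipschitz_on_continuous_on[where L = 1], rule lipschitz_onI)
  fix x y :: real
  have "\<bar>p_value x - p_value y\<bar> \<le> y - x" if "x \<le> y" for x y
    using p_value_diff[OF that] measure_std_normal_interval_le[OF that] by simp
  from this[of x y] this[of y x] show "dist (p_value x) (p_value y) \<le> 1 * dist x y"
    by (cases "x \<le> y") (auto simp: dist_real_def abs_minus_commute)
qed simp

lemma p_value_measurable [measurable]: "p_value \<in> borel_measurable borel"
  by (rule borel_measurable_continuous_onI[OF continuous_p_value])

text \<open>Intermediate value theorem, with endpoints supplied by the limits of the distribution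
  function.\<close>

lemma p_value_surj:
  assumes "0 < c" "c < 1"
  obtains x where "p_value x = c"
proof -
  interpret real_distribution "normal_law 0" by (rule real_distribution_normal_law)
  have "\<forall>\<^sub>F x in at_top. 1 - c < cdf (normal_law 0) x"
    by (rule order_tendstoD(1)[OF cdf_lim_at_top_prob]) (use assms in simp)
  then obtain b where "1 - c < cdf (normal_law 0) b"
    using eventually_happens'[OF trivial_limit_at_top_linorder] by blast
  then have b: "p_value b < c"
    unfolding p_value_eq_1_minus_cdf by simp
  have "\<forall>\<^sub>F x in at_bot. cdf (normal_law 0) x < 1 - c"
    by (rule order_tendstoD(2)[OF cdf_lim_at_bot]) (use assms in simp)
  then obtain a where "cdf (normal_law 0) a < 1 - c"
    using eventually_happens'[OF trivial_limit_at_bot_linorder] by blast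
  then have a: "c < p_value a"
    unfolding p_value_eq_1_minus_cdf by simp
  have "a \<le> b"
    using a b p_value_le_iff[of b a] by simp
  then obtain x where "p_value x = c"
    using IVT2'[of p_value b c a] a b continuous_on_subset[OF continuous_p_value] by auto
  then show thesis by (rule that)
qed

text \<open>Probability integral transform: the p-value is uniform under the null law, so minus its
  logarithm is exponential with rate 1.\<close>

lemma distr_neg_ln_p_value: "distr (normal_law 0) borel (\<lambda>x. - ln (p_value x)) = erlang_law 0"
proof -
  interpret real_distribution "normal_law 0" by (rule real_distribution_normal_law)
  have "prob {x. - ln (p_value x) \<le> a} = 1 - exp (- a)" if "a \<ge> 0" for a
  proof (cases "a = 0")
    \<comment> \<open>The value \<open>exp (- 0) = 1\<close> is not attained by
      \<open>p_value\<close>, but here the event is empty.\<close>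
    case True
    have "{x. - ln (p_value x) \<le> a} = {}"
      using p_value_bounds ln_less_zero by (force simp: True not_le)
    then show ?thesis using True by simp
  next
    case False
    then obtain z where z: "p_value z = exp (- a)"
      using p_value_surj[of "exp (- a)"] \<open>a \<ge> 0\<close> by auto
    have "- ln (p_value x) \<le> a \<longleftrightarrow> x \<le> z" for x
    proof -
      have "- ln (p_value x) \<le> a \<longleftrightarrow> exp (- a) \<le> p_value x"
        using ln_ge_iff[OF p_value_bounds(1), of "- a" x] by linarith
      then show ?thesis by (simp add: z[symmetric] p_value_le_iff)
    qed
    then have "{x. - ln (p_value x) \<le> a} = {..z}" by auto
    then show ?thesis
      using p_value_eq_1_minus_cdf[of z] z by (simp add: cdf_def)
  qed
  then have "distributed (normal_law 0) lborel (\<lambda>x. - ln (p_value x)) (erlang_density 0 1)"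
    by (subst exponential_distributed_iff) auto
  then show ?thesis
    by (simp add: distributed_def cong: distr_cong)
qed

text \<open>The tail beyond \<open>x\<close> contains the unit interval to the right of
  \<open>\<bar>x\<bar>\<close>, where the density is at least its value at
  \<open>\<bar>x\<bar> + 1\<close>. The 5 collects \<open>ln (2 * pi) / 2 \<le> 4\<close> and
  \<open>(\<bar>x\<bar> + 1)\<^sup>2 / 2 \<le> x\<^sup>2 + 1\<close>.\<close>

lemma neg_ln_p_value_bounds: "0 \<le> - ln (p_value x)" "- ln (p_value x) \<le> x\<^sup>2 + 5"
proof -
  show "0 \<le> - ln (p_value x)"
    using p_value_bounds[of x] by simp
  interpret real_distribution "normal_law 0" by (rule real_distribution_normal_law)
  have "std_normal_density (\<bar>x\<bar> + 1) * (\<bar>x\<bar> + 1 - \<bar>x\<bar>) \<le> measure (normal_law 0) {\<bar>x\<bar><..\<bar>x\<bar> + 1}"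
    by (rule measure_std_normal_interval_ge) auto
  also have "\<dots> \<le> p_value x"
    unfolding p_value_def by (rule finite_measure_mono) auto
  finally have "ln (std_normal_density (\<bar>x\<bar> + 1)) \<le> ln (p_value x)"
    by (intro ln_mono normal_density_pos) auto
  moreover have "ln (std_normal_density (\<bar>x\<bar> + 1)) = - (ln (2 * pi) / 2) - (\<bar>x\<bar> + 1)\<^sup>2 / 2"
    by (simp add: std_normal_density_def ln_mult ln_div ln_sqrt)
  moreover have "ln (2 * pi) \<le> 8"
    using ln_le_minus_one[of "2 * pi"] pi_less_4 by simp
  moreover have "(\<bar>x\<bar> + 1)\<^sup>2 \<le> 2 * x\<^sup>2 + 2"
    using sum_squares_bound[of "\<bar>x\<bar>" 1] by (simp add: power2_sum)
  ultimately show "- ln (p_value x) \<le> x\<^sup>2 + 5" by simp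
qed

text \<open>Integrates the pointwise bound; the 6 is its constant 5 plus the variance 1.\<close>

lemma integrable_neg_ln_p_value: "integrable (normal_law \<mu>) (\<lambda>x. - ln (p_value x))"
  and integral_neg_ln_p_value_le: "(\<integral>x. \<bar>- ln (p_value x)\<bar> \<partial>normal_law \<mu>) \<le> \<mu>\<^sup>2 + 6"
proof -
  interpret real_distribution "normal_law \<mu>" by (rule real_distribution_normal_law)
  note sq = has_bochner_integral_normal_law_square[of \<mu>, THEN has_bochner_integral_iff[THEN iffD1]]
  have int: "integrable (normal_law \<mu>) (\<lambda>x. x\<^sup>2 + 5)"
    using sq by (intro Bochner_Integration.integrable_add integrable_const) (rule conjunct1)
  show int': "integrable (normal_law \<mu>) (\<lambda>x. - ln (p_value x))"
  proof (rule Bochner_Integration.integrable_bound[OF int])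
    show "AE x in normal_law \<mu>. norm (- ln (p_value x)) \<le> norm (x\<^sup>2 + 5)"
      unfolding real_norm_def abs_of_nonneg[OF neg_ln_p_value_bounds(1)]
      using order_trans[OF neg_ln_p_value_bounds(2) abs_ge_self] by (intro AE_I2)
  qed simp
  have "(\<integral>x. \<bar>- ln (p_value x)\<bar> \<partial>normal_law \<mu>) \<le> (\<integral>x. x\<^sup>2 + 5 \<partial>normal_law \<mu>)"
    unfolding abs_of_nonneg[OF neg_ln_p_value_bounds(1)]
    by (rule integral_mono[OF int' int neg_ln_p_value_bounds(2)])
  also have "\<dots> = \<mu>\<^sup>2 + 6"
    using sq prob_space by simp
  finally show "(\<integral>x. \<bar>- ln (p_value x)\<bar> \<partial>normal_law \<mu>) \<le> \<mu>\<^sup>2 + 6" .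
qed

section \<open>Mixture law and the sum of the two errors\<close>

lemma integral_mixture_law:
  fixes f :: "real \<Rightarrow> real"
  assumes \<epsilon>: "0 \<le> \<epsilon>" "\<epsilon> \<le> 1"
    and f: "integrable (normal_law 0) f" "integrable (normal_law \<mu>) f"
  shows "(\<integral>x. f x \<partial>mixture_law \<epsilon> \<mu>) =
      (1 - \<epsilon>) * (\<integral>x. f x \<partial>normal_law 0) + \<epsilon> * (\<integral>x. f x \<partial>normal_law \<mu>)"
proof -
  have [measurable]: "f \<in> borel_measurable borel"
    using borel_measurable_integrable[OF f(1)] by (simp add: normal_law_def)
  have int: "integrable lborel (\<lambda>x. normal_density 0 1 x * f x)" "integrable lborel (\<lambda>x. normal_density \<mu> 1 x * f x)"
    using f unfolding normal_law_def by (simp_all add: integrable_density)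
  have nonneg: "0 \<le> (1 - \<epsilon>) * normal_density 0 1 x + \<epsilon> * normal_density \<mu> 1 x" for x
    using \<epsilon> by simp
  have distrib: "((1 - \<epsilon>) * normal_density 0 1 x + \<epsilon> * normal_density \<mu> 1 x) * f x =
      (1 - \<epsilon>) * (normal_density 0 1 x * f x) + \<epsilon> * (normal_density \<mu> 1 x * f x)" for x
    by (simp add: algebra_simps)
  show "(\<integral>x. f x \<partial>mixture_law \<epsilon> \<mu>) =
      (1 - \<epsilon>) * (\<integral>x. f x \<partial>normal_law 0) + \<epsilon> * (\<integral>x. f x \<partial>normal_law \<mu>)"
    unfolding mixture_law_def normal_law_def
    using int by (simp add: integral_density nonneg distrib)
qed

lemma real_distribution_mixture_law:
  assumes \<epsilon>: "0 \<le> \<epsilon>" "\<epsilon> \<le> 1"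
  shows "real_distribution (mixture_law \<epsilon> \<mu>)"
proof -
  have nonneg: "0 \<le> (1 - \<epsilon>) * normal_density 0 1 x + \<epsilon> * normal_density \<mu> 1 x" for x
    using \<epsilon> by simp
  have "emeasure (mixture_law \<epsilon> \<mu>) UNIV =
      (\<integral>\<^sup>+x. ennreal ((1 - \<epsilon>) * normal_density 0 1 x + \<epsilon> * normal_density \<mu> 1 x) \<partial>lborel)"
    unfolding mixture_law_def by (subst emeasure_density) auto
  also have "\<dots> = 1"
    by (subst nn_integral_eq_integral) (auto simp: nonneg)
  finally have "prob_space (mixture_law \<epsilon> \<mu>)"
    by (intro prob_spaceI) (simp add: mixture_law_def)
  then show ?thesis
    by (intro real_distribution.intro real_distribution_axioms.intro) (simp_all add: mixture_law_def)
qed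

text \<open>The sum of errors is 1 minus the difference of the rejection probabilities under the two
  hypotheses. Both are iterated averages of one test function, so the contamination bound controls
  the difference.\<close>

lemma fisher_errors_ge:
  assumes \<epsilon>: "0 \<le> \<epsilon>" "\<epsilon> \<le> 1" and \<psi>: "critical_function borel \<psi>"
  shows "1 - \<epsilon> * (2 + 2 * (\<mu>\<^sup>2 + 7) * sqrt k) \<le>
      type_I_error (iid_sample (Suc (Suc k)) (normal_law 0)) (\<lambda>x. \<psi> (fisher_stat (Suc (Suc k)) x)) +
      type_II_error (iid_sample (Suc (Suc k)) (mixture_law \<epsilon> \<mu>)) (\<lambda>x. \<psi> (fisher_stat (Suc (Suc k)) x))"
proof -
  define n where "n = Suc (Suc k)"
  define L where "L x = - ln (p_value x)" for x
  \<comment> \<open>Absorbs the factor 2 of Fisher's statistic, which leaves a plain sum of values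
    of \<open>L\<close>.\<close>
  define h where "h s = \<psi> (2 * s)" for s
  let ?N = "distr (normal_law \<mu>) borel L" and ?Q = "distr (mixture_law \<epsilon> \<mu>) borel L"
  interpret N0: real_distribution "normal_law 0" by (rule real_distribution_normal_law)
  interpret N: real_distribution "normal_law \<mu>" by (rule real_distribution_normal_law)
  interpret Q: real_distribution "mixture_law \<epsilon> \<mu>" by (rule real_distribution_mixture_law[OF \<epsilon>])
  note [measurable] = critical_functionD(1)[OF \<psi>]
  have L [measurable]: "L \<in> borel_measurable borel"
    unfolding L_def[abs_def] by measurable
  have [measurable]: "h \<in> borel_measurable borel"
    unfolding h_def[abs_def] by measurable
  have h: "critical_function borel h"
    using critical_functionD(2,3)[OF \<psi>] by (simp add: critical_function_def h_def)
  have dN: "real_distribution ?N" and dQ: "real_distribution ?Q"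
    by (simp_all add: N.real_distribution_distr Q.real_distribution_distr)
  have fisher: "\<psi> (fisher_stat n x) = h (0 + (\<Sum>i=1..n. L (x i)))" for x
    by (simp add: h_def L_def fisher_stat_def sum_negf)
  have E0: "(\<integral>x. \<psi> (fisher_stat n x) \<partial>iid_sample n (normal_law 0)) = (avg (erlang_law 0) ^^ n) h 0"
    unfolding fisher iid_sample_def
    by (subst integral_iid_sum[OF N0.prob_space_axioms _ h])
       (simp_all add: L_def[abs_def] distr_neg_ln_p_value)
  have E1: "(\<integral>x. \<psi> (fisher_stat n x) \<partial>iid_sample n (mixture_law \<epsilon> \<mu>)) = (avg ?Q ^^ n) h 0"
    unfolding fisher iid_sample_def
    by (subst integral_iid_sum[OF Q.prob_space_axioms _ h]) simp_all
  interpret H1: prob_space "iid_sample n (mixture_law \<epsilon> \<mu>)"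
    unfolding iid_sample_def by (intro prob_space_PiM Q.prob_space_axioms)
  have "integrable (iid_sample n (mixture_law \<epsilon> \<mu>)) (\<lambda>x. \<psi> (fisher_stat n x))"
  proof (rule H1.integrable_const_bound[where B = 1])
    show "(\<lambda>x. \<psi> (fisher_stat n x)) \<in> borel_measurable (iid_sample n (mixture_law \<epsilon> \<mu>))"
      unfolding fisher h_def iid_sample_def by measurable
  qed (simp add: critical_functionD[OF \<psi>])
  then have II: "type_II_error (iid_sample n (mixture_law \<epsilon> \<mu>)) (\<lambda>x. \<psi> (fisher_stat n x))
      = 1 - (avg ?Q ^^ n) h 0"
    unfolding type_II_error_def E1[symmetric]
    by (subst Bochner_Integration.integral_diff) (simp_all add: H1.prob_space)
  \<comment> \<open>The image of the mixture under \<open>L\<close> is again a mixture, and its null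
    part is exponential.\<close>
  have mix: "avg ?Q f s = (1 - \<epsilon>) * avg (erlang_law 0) f s + \<epsilon> * avg ?N f s"
    if f: "critical_function borel f" for f s
  proof -
    note fm [measurable] = critical_functionD(1)[OF f]
    have "integrable (normal_law \<nu>) (\<lambda>x. f (s + L x))" for \<nu>
    proof -
      interpret real_distribution "normal_law \<nu>" by (rule real_distribution_normal_law)
      show ?thesis
        by (rule integrable_const_bound[where B = 1]) (simp_all add: critical_functionD[OF f])
    qed
    then have "(\<integral>x. f (s + L x) \<partial>mixture_law \<epsilon> \<mu>) =
        (1 - \<epsilon>) * (\<integral>x. f (s + L x) \<partial>normal_law 0) + \<epsilon> * (\<integral>x. f (s + L x) \<partial>normal_law \<mu>)"
      by (intro integral_mixture_law \<epsilon>)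
    moreover have "erlang_law 0 = distr (normal_law 0) borel L"
      by (simp add: L_def[abs_def] distr_neg_ln_p_value)
    ultimately show ?thesis
      unfolding avg_def by (simp add: integral_distr)
  qed
  have iN: "integrable ?N (\<lambda>y. y)"
    using integrable_neg_ln_p_value[of \<mu>] by (subst integrable_distr_eq) (simp_all add: L_def[abs_def])
  have "(\<integral>y. \<bar>y\<bar> \<partial>?N) = (\<integral>x. \<bar>L x\<bar> \<partial>normal_law \<mu>)"
    by (subst integral_distr) simp_all
  also have "\<dots> \<le> \<mu>\<^sup>2 + 6"
    unfolding L_def by (rule integral_neg_ln_p_value_le)
  \<comment> \<open>The 7 is 6 from the contaminating law plus 1 from the exponential
    summand.\<close>
  finally have "\<epsilon> * (2 + 2 * (1 + (\<integral>y. \<bar>y\<bar> \<partial>?N)) * sqrt k) \<le> \<epsilon> * (2 + 2 * (\<mu>\<^sup>2 + 7) * sqrt k)"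
    using \<epsilon> by (intro mult_left_mono add_left_mono mult_right_mono) auto
  with funpow_avg_contamination_bound[OF dN iN dQ mix \<epsilon>(1) h, of k 0]
  have "(avg ?Q ^^ n) h 0 - (avg (erlang_law 0) ^^ n) h 0 \<le> \<epsilon> * (2 + 2 * (\<mu>\<^sup>2 + 7) * sqrt k)"
    unfolding n_def by linarith
  then show ?thesis
    unfolding n_def[symmetric] II type_I_error_def E0 by simp
qed

section \<open>Asymptotics and conclusion\<close>

text \<open>The dominant term is \<open>real n powr (1 / 2 - \<beta>)\<close> times a logarithm; its
  negative exponent is where \<open>\<beta> > 1 / 2\<close> enters.\<close>

lemma powr_minus_mult_ln_sqrt_tendsto_0:
  fixes \<beta> :: real
  assumes "\<beta> > 1 / 2"
  shows "(\<lambda>n. real n powr (- \<beta>) * (2 + 2 * (2 * ln (real n) + 7) * sqrt (real n))) \<longlonglongrightarrow> 0"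
proof -
  have "a * (2 + 2 * (2 * l + 7) * s) = a * 2 + a * s * (4 * l + 14)" for a l s :: real
    by (simp add: algebra_simps)
  moreover have "real n powr (- \<beta>) * sqrt (real n) = real n powr (- (\<beta> - 1 / 2))" for n
    by (simp add: powr_half_sqrt[symmetric] flip: powr_add)
  ultimately have "(\<lambda>n. real n powr (- \<beta>) * (2 + 2 * (2 * ln (real n) + 7) * sqrt (real n))) =
      (\<lambda>n. real n powr (- \<beta>) * 2 + real n powr (- (\<beta> - 1 / 2)) * (4 * ln (real n) + 14))"
    by presburger
  moreover have lim: "(\<lambda>n. real n powr (- b) * 2) \<longlonglongrightarrow> 0"
    "(\<lambda>n. real n powr (- b) * (4 * ln (real n) + 14)) \<longlonglongrightarrow> 0" if "b > 0" for b :: real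
    using that by real_asymp+
  have "(\<lambda>n. real n powr (- \<beta>) * 2 + real n powr (- (\<beta> - 1 / 2)) * (4 * ln (real n) + 14))
      \<longlonglongrightarrow> 0 + 0"
    using assms by (intro tendsto_add lim) simp_all
  ultimately show ?thesis by simp
qed

theorem theorem1p5:
  fixes \<beta> :: real and \<epsilon> \<mu> :: "nat \<Rightarrow> real"
  assumes "\<beta> > 1 / 2"
    and "\<And>n. n \<ge> 1 \<Longrightarrow> \<epsilon> n = real n powr (- \<beta>)"
    and "\<And>n. n \<ge> 2 \<Longrightarrow> 0 < \<mu> n \<and> \<mu> n \<le> sqrt (2 * ln (real n))"
  shows "unable_to_separate
           (\<lambda>n. iid_sample n (normal_law 0))
           (\<lambda>n. iid_sample n (mixture_law (\<epsilon> n) (\<mu> n)))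
           fisher_stat"
proof -
  have False
    if \<psi>: "\<And>n. critical_function borel (\<psi> n)"
      and sep: "separates_asymptotically (\<lambda>n. iid_sample n (normal_law 0))
        (\<lambda>n. iid_sample n (mixture_law (\<epsilon> n) (\<mu> n))) (\<lambda>n x. \<psi> n (fisher_stat n x))"
    for \<psi> :: "nat \<Rightarrow> real \<Rightarrow> real"
  proof -
    let ?err = "\<lambda>n. type_I_error (iid_sample n (normal_law 0)) (\<lambda>x. \<psi> n (fisher_stat n x)) +
        type_II_error (iid_sample n (mixture_law (\<epsilon> n) (\<mu> n))) (\<lambda>x. \<psi> n (fisher_stat n x))"
    let ?r = "\<lambda>n. real n powr (- \<beta>) * (2 + 2 * (2 * ln (real n) + 7) * sqrt (real n))"
    \<comment> \<open>The finite-sample bound is for \<open>Suc (Suc k)\<close> observations, and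
      \<mu> is controlled from 2 on.\<close>
    have "1 - ?r n \<le> ?err n" if "n \<ge> 2" for n
    proof -
      define k where "k = n - 2"
      have k: "n = Suc (Suc k)"
        using that by (simp add: k_def)
      have \<epsilon>: "0 \<le> \<epsilon> n" "\<epsilon> n \<le> 1"
        using powr_mono[of "- \<beta>" 0 "real n"] assms(1) assms(2)[of n] that by auto
      have "(\<mu> n)\<^sup>2 \<le> (sqrt (2 * ln (real n)))\<^sup>2"
        using assms(3)[OF that] by (intro power_mono) auto
      then have "(\<mu> n)\<^sup>2 \<le> 2 * ln (real n)"
        using that by simp
      then have "2 + 2 * ((\<mu> n)\<^sup>2 + 7) * sqrt (real k) \<le> 2 + 2 * (2 * ln (real n) + 7) * sqrt (real n)"
        using that by (intro add_left_mono mult_mono) (simp_all add: k)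
      then have "\<epsilon> n * (2 + 2 * ((\<mu> n)\<^sup>2 + 7) * sqrt (real k)) \<le> ?r n"
        using \<epsilon>(1) assms(2)[of n] that by (simp add: mult_left_mono)
      then show ?thesis
        using fisher_errors_ge[OF \<epsilon> \<psi>[of n], of "\<mu> n" k] unfolding k[symmetric] by linarith
    qed
    then have "\<forall>\<^sub>F n in sequentially. 1 - ?r n \<le> ?err n"
      by (auto simp: eventually_sequentially)
    moreover have "?r \<longlonglongrightarrow> 0"
      using assms(1) by (rule powr_minus_mult_ln_sqrt_tendsto_0)
    then have "(\<lambda>n. 1 - ?r n) \<longlonglongrightarrow> 1 - 0"
      by (intro tendsto_diff tendsto_const)
    moreover have "?err \<longlonglongrightarrow> 0"
      using sep unfolding separates_asymptotically_def .
    \<comment> \<open>The lower bound for the errors tends to 1, whereas separation sends the errors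
      to 0.\<close>
    ultimately have "(1 :: real) - 0 \<le> 0"
      by (intro tendsto_le[OF sequentially_bot])
    then show False by simp
  qed
  then show ?thesis
    unfolding unable_to_separate_def by blast
qed

end
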